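(* Let $n>1$ be a prime number. A graph $G$ of order $n$ is a Diophantine graph if and only if $G$ is a prime graph.
   Context: All graphs are finite, simple and undirected, and $(a,b)$ denotes the greatest common divisor of $a$ and $b$. A graph $G=(V,E)$ of order $n$ is a prime graph if there is a bijection $f:V\to\{1,2,\dots,n\}$ such that $(f(u),f(v))=1$ for all $uv\in E$. It is a Diophantine graph if there is a bijection $f:V\to\{1,2,\dots,n\}$ such that $(f(u),f(v))\mid n$ for all $uv\in E$. *)

theory Defs
  imports
    "HOL-Computational_Algebra.Primes"
    "Graph_Theory.Digraph"
begin

text \<open>
  A finite simple undirected graph is an instance of the locale \<open>graph\<close>: a finite loopfree digraph
  without parallel arcs whose arc relation is symmetric.  The undirected edge \<open>uv\<close> is represented by
  the two arcs \<open>u \<rightarrow>\<^bsub>G\<^esub> v\<close> and \<open>v \<rightarrow>\<^bsub>G\<^esub> u\<close>.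
\<close>

definition is_prime_graph :: "('a, 'b) pre_digraph \<Rightarrow> bool" where
  "is_prime_graph G \<longleftrightarrow> graph G \<and>
    (\<exists>f :: 'a \<Rightarrow> nat. bij_betw f (verts G) {1..card (verts G)} \<and>
      (\<forall>u v. u \<rightarrow>\<^bsub>G\<^esub> v \<longrightarrow> gcd (f u) (f v) = 1))"

definition is_diophantine_graph :: "('a, 'b) pre_digraph \<Rightarrow> bool" where
  "is_diophantine_graph G \<longleftrightarrow> graph G \<and>
    (\<exists>f :: 'a \<Rightarrow> nat. bij_betw f (verts G) {1..card (verts G)} \<and>
      (\<forall>u v. u \<rightarrow>\<^bsub>G\<^esub> v \<longrightarrow> gcd (f u) (f v) dvd card (verts G)))"

end

theory Submission
  imports Defs
begin

text \<open>
  If a label gcd divides the prime \<open>n\<close> but is not \<open>1\<close>, it equals \<open>n\<close>, so both labels are multiples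
  of \<open>n\<close> in \<open>{1..n}\<close>; then both are \<open>n\<close>, and injectivity would turn the edge into a loop.
\<close>

lemma gcd_dvd_prime_iff:
  fixes a b n :: nat
  assumes "prime n" "a \<in> {1..n}" "b \<in> {1..n}" "a \<noteq> b"
  shows "gcd a b dvd n \<longleftrightarrow> gcd a b = 1"
proof
  assume "gcd a b dvd n"
  then have "gcd a b = 1 \<or> gcd a b = n"
    using \<open>prime n\<close> by (simp add: prime_nat_iff)
  moreover have "gcd a b \<noteq> n"
  proof
    assume "gcd a b = n"
    then have "n dvd a" "n dvd b"
      by (metis gcd_dvd1, metis gcd_dvd2)
    \<comment> \<open>The lower end 1 of the range matters: it excludes the multiple 0, so
      divisibility by \<open>n\<close> forces a label to be at least \<open>n\<close>.\<close>
    then have "a = n" "b = n"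
      using assms(2,3) by (auto dest!: dvd_imp_le)
    with \<open>a \<noteq> b\<close> show False by simp
  qed
  ultimately show "gcd a b = 1" by blast
qed simp

theorem theorem2p1:
  fixes G :: "('a, 'b) pre_digraph" and n :: nat
  assumes "n > 1" and "prime n"
    and "graph G" and "card (verts G) = n"
  shows "is_diophantine_graph G \<longleftrightarrow> is_prime_graph G"
proof -
  interpret graph G by fact
  \<comment> \<open>The two conditions agree for each fixed labelling, arc by arc, so the same
    \<open>f\<close> witnesses both properties.\<close>
  have "gcd (f u) (f v) dvd n \<longleftrightarrow> gcd (f u) (f v) = 1"
    if f: "bij_betw f (verts G) {1..n}" and uv: "u \<rightarrow>\<^bsub>G\<^esub> v" for f :: "'a \<Rightarrow> nat" and u v
  proof (rule gcd_dvd_prime_iff[OF \<open>prime n\<close>])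
    \<comment> \<open>Looplessness of \<open>G\<close> enters here; membership in
      \<open>verts G\<close> is what makes injectivity of \<open>f\<close> applicable.\<close>
    have "u \<in> verts G" "v \<in> verts G" "u \<noteq> v"
      using uv by (auto dest: adj_in_verts adj_not_same)
    then show "f u \<in> {1..n}" "f v \<in> {1..n}" "f u \<noteq> f v"
      using f by (blast dest: bij_betwE, blast dest: bij_betwE, meson bij_betw_def inj_onD)
  qed
  then show ?thesis
    unfolding is_diophantine_graph_def is_prime_graph_def \<open>card (verts G) = n\<close> by blast
qed

end
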